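(* Let $\mathbb{F}_q$ be a finite field of characteristic $p$ and let $f,g\in\mathbb{F}_q[x]$ be polynomials with $f$ monic. Then for every non-degenerate linear functional $\psi\colon\mathbb{F}_q[x]/(f)\to\mathbb{F}_q$, the Ramanujan sum $c(g,f)=c_\psi(g,f)$ satisfies \[ c(g,f)=\mu(t)\,\frac{\varphi(f)}{\varphi(t)},\qquad\text{where } t=\frac{f}{\gcd(f,g)}. \] In particular, $c(g,f)$ is an integer.
   Context: A non-degenerate linear functional on $\mathbb{F}_q[x]/(f)$ is an $\mathbb{F}_q$-linear map $\psi\colon\mathbb{F}_q[x]/(f)\to\mathbb{F}_q$ whose kernel contains no nonzero ideal. Fix a primitive $p$-th root of unity $\zeta_p\in\mathbb{C}$ and let $\mathrm{Tr}\colon\mathbb{F}_q\to\mathbb{F}_p$ be the trace. The Ramanujan sum is \[ c_\psi(g,f)=\sum_{a\in(\mathbb{F}_q[x]/(f))^\times}\zeta_p^{\mathrm{Tr}(\psi(ga))}. \] Here $\gcd$ is taken monic (with $\gcd(f,0)=f$); $\varphi(h)=|(\mathbb{F}_q[x]/(h))^\times|$; and $\mu$ is the Möbius function on $\mathbb{F}_q[x]$: $\mu(h)=(-1)^r$ if $h$ is a nonzero constant times a product of $r\ge 0$ distinct monic irreducible polynomials, and $\mu(h)=0$ if $h$ is not squarefree. *)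

theory Defs
  imports
    Complex_Main
    "HOL-Library.Cardinality"
    "HOL-Algebra.Sylow"
    "HOL-Algebra.QuotRing"
    "HOL-Computational_Algebra.Polynomial_Factorial"
    "HOL-Computational_Algebra.Squarefree"
begin

abbreviation poly_ring :: "'a::field poly ring" where
  "poly_ring \<equiv> \<lparr>carrier = UNIV, monoid.mult = (*), one = 1, zero = 0, add = (+)\<rparr>"

definition poly_quot :: "'a::field poly \<Rightarrow> 'a poly set ring" where
  "poly_quot f = poly_ring Quot (PIdl\<^bsub>poly_ring\<^esub> f)"

definition poly_class :: "'a::field poly \<Rightarrow> 'a poly \<Rightarrow> 'a poly set" where
  "poly_class f h = (PIdl\<^bsub>poly_ring\<^esub> f) +>\<^bsub>poly_ring\<^esub> h"

definition poly_phi :: "'a::field poly \<Rightarrow> nat" where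
  "poly_phi h = card (Units (poly_quot h))"

text \<open>
  Functionals are total functions on sets of polynomials; only their values on the cosets
  forming the carrier of the quotient are constrained or used. Scalars act through the classes
  of constant polynomials.
\<close>

definition quot_functional :: "'a::field poly \<Rightarrow> ('a poly set \<Rightarrow> 'a) \<Rightarrow> bool" where
  "quot_functional f \<psi> \<longleftrightarrow>
     (\<forall>x \<in> carrier (poly_quot f). \<forall>y \<in> carrier (poly_quot f).
        \<psi> (x \<oplus>\<^bsub>poly_quot f\<^esub> y) = \<psi> x + \<psi> y) \<and>
     (\<forall>c. \<forall>x \<in> carrier (poly_quot f).
        \<psi> (poly_class f [:c:] \<otimes>\<^bsub>poly_quot f\<^esub> x) = c * \<psi> x)"

definition nondegenerate_functional :: "'a::field poly \<Rightarrow> ('a poly set \<Rightarrow> 'a) \<Rightarrow> bool" where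
  "nondegenerate_functional f \<psi> \<longleftrightarrow>
     quot_functional f \<psi> \<and>
     (\<forall>I. ideal I (poly_quot f) \<and> (\<forall>x\<in>I. \<psi> x = 0) \<longrightarrow> I = {\<zero>\<^bsub>poly_quot f\<^esub>})"

definition primitive_root_of_unity :: "nat \<Rightarrow> complex \<Rightarrow> bool" where
  "primitive_root_of_unity n z \<longleftrightarrow> z ^ n = 1 \<and> (\<forall>k. 0 < k \<and> k < n \<longrightarrow> z ^ k \<noteq> 1)"

definition prime_field_degree :: "'a::finite_field itself \<Rightarrow> nat" where
  "prime_field_degree _ = (THE n. CARD('a) = CHAR('a) ^ n)"

text \<open>
  The Galois group over the prime field is generated by the \<open>p\<close>-th power map, so the trace is
  \<open>x + x\<^sup>p + \<dots> + x\<^bsup>p^(n-1)\<^esup>\<close>. It is an element of the prime subfield, and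
  \<open>trace_rep\<close> is its representative in \<open>{0, \<dots>, p - 1}\<close>, which serves as the exponent of a
  \<open>p\<close>-th root of unity.
\<close>

definition field_trace :: "'a::finite_field \<Rightarrow> 'a" where
  "field_trace x = (\<Sum>i<prime_field_degree TYPE('a). x ^ (CHAR('a) ^ i))"

definition trace_rep :: "'a::finite_field \<Rightarrow> nat" where
  "trace_rep x = (THE k. k < CHAR('a) \<and> of_nat k = field_trace x)"

definition ramanujan_sum ::
    "complex \<Rightarrow> ('a::finite_field poly set \<Rightarrow> 'a) \<Rightarrow> 'a poly \<Rightarrow> 'a poly \<Rightarrow> complex" where
  "ramanujan_sum \<zeta> \<psi> g f =
     (\<Sum>a \<in> Units (poly_quot f). \<zeta> ^ trace_rep (\<psi> (poly_class f g \<otimes>\<^bsub>poly_quot f\<^esub> a)))"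

text \<open>
  The library's \<open>gcd\<close> on polynomials needs the coefficient type to be in class \<open>field_gcd\<close>;
  this version works over every field and agrees with it there.
\<close>

definition monic_gcd :: "'a::field poly \<Rightarrow> 'a poly \<Rightarrow> 'a poly" where
  "monic_gcd f g =
     (THE d. lead_coeff d = 1 \<and> d dvd f \<and> d dvd g \<and> (\<forall>e. e dvd f \<and> e dvd g \<longrightarrow> e dvd d))"

definition distinct_irreducible_product :: "'a::field poly \<Rightarrow> nat \<Rightarrow> bool" where
  "distinct_irreducible_product h r \<longleftrightarrow>
     (\<exists>c S. c \<noteq> 0 \<and> finite S \<and> card S = r \<and>
        (\<forall>\<pi>\<in>S. irreducible \<pi> \<and> lead_coeff \<pi> = 1) \<and> h = smult c (\<Prod>\<pi>\<in>S. \<pi>))"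

definition poly_mobius :: "'a::field poly \<Rightarrow> int" where
  "poly_mobius h =
     (if squarefree h then (-1) ^ (THE r. distinct_irreducible_product h r) else 0)"

lemma monic_dvd_antisym:
  fixes d e :: "'a::field poly"
  assumes "lead_coeff d = 1" "lead_coeff e = 1" "d dvd e" "e dvd d"
  shows "d = e"
proof -
  obtain k where k: "e = d * k" using assms(3) by blast
  have "degree d = degree e"
    using assms by (metis dvd_imp_degree_le leading_coeff_0_iff order_antisym zero_neq_one)
  moreover have "k \<noteq> 0" "d \<noteq> 0" using assms k by auto
  ultimately have "degree k = 0" using k by (simp add: degree_mult_eq)
  then obtain c where "k = [:c:]" by (rule degree_eq_zeroE)
  with k have "e = smult c d" by simp
  moreover from this have "lead_coeff e = c * lead_coeff d" by simp
  ultimately have "c = 1" using assms(1,2) by (metis mult.right_neutral)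
  with \<open>e = smult c d\<close> show ?thesis by simp
qed

lemma monic_gcd_eqI:
  assumes "lead_coeff d = 1" "d dvd f" "d dvd g" "\<And>e. e dvd f \<Longrightarrow> e dvd g \<Longrightarrow> e dvd d"
  shows "monic_gcd f g = d"
  unfolding monic_gcd_def
  by (rule the_equality) (use assms in \<open>auto intro: monic_dvd_antisym\<close>)

lemma monic_gcd_0_right: "lead_coeff f = 1 \<Longrightarrow> monic_gcd f 0 = f"
  by (rule monic_gcd_eqI) auto

lemma monic_gcd_eq_gcd:
  fixes f g :: "'a::field_gcd poly"
  assumes "f \<noteq> 0 \<or> g \<noteq> 0"
  shows "monic_gcd f g = gcd f g"
proof (rule monic_gcd_eqI)
  have "gcd f g \<noteq> 0" using assms by simp
  then have "unit_factor (gcd f g) = 1" using assms by (auto simp: unit_factor_gcd)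
  then have "unit_factor (lead_coeff (gcd f g)) = 1"
    by (simp add: unit_factor_poly_def one_pCons)
  then show "lead_coeff (gcd f g) = 1"
    using \<open>gcd f g \<noteq> 0\<close> by (metis dvd_field_iff is_unit_unit_factor leading_coeff_0_iff one_neq_zero)
qed auto

lemma bezout_field_poly:
  fixes f g :: "'a::field poly"
  assumes "f \<noteq> 0"
  shows "\<exists>d u v. lead_coeff d = 1 \<and> d dvd f \<and> d dvd g \<and> d = u * f + v * g"
proof -
  define P where "P = (\<lambda>d. d \<noteq> 0 \<and> (\<exists>u v. d = u * f + v * g))"
  have "P f" unfolding P_def using assms by (metis add.right_neutral mult_1 mult_zero_left)
  then obtain d where "P d" and min: "\<And>e. P e \<Longrightarrow> degree d \<le> degree e"
    using ex_has_least_nat[of P f degree] by blast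
  from \<open>P d\<close> obtain u v where d: "d = u * f + v * g" "d \<noteq> 0" unfolding P_def by blast
  have dvd: "d dvd a * f + b * g" for a b
  proof (rule ccontr)
    let ?h = "a * f + b * g"
    assume *: "\<not> d dvd ?h"
    have "?h mod d = ?h - (?h div d) * d" by (simp add: minus_div_mult_eq_mod)
    also have "\<dots> = (a - (?h div d) * u) * f + (b - (?h div d) * v) * g"
    proof -
      have "q * d = q * u * f + q * v * g" for q
        by (subst d(1)) (simp add: algebra_simps)
      from this[of "?h div d"] show ?thesis by (simp only:) (simp add: algebra_simps)
    qed
    finally have "P (?h mod d)" using * unfolding P_def by (auto simp: dvd_eq_mod_eq_0)
    with min have "degree d \<le> degree (?h mod d)" by blast
    with degree_mod_less_degree[OF d(2) *] show False by simp
  qed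
  let ?c = "inverse (lead_coeff d)"
  have "lead_coeff (smult ?c d) = 1" using d(2) by simp
  moreover have "smult ?c d dvd f" "smult ?c d dvd g"
    using dvd[of 1 0] dvd[of 0 1] d(2) by (auto intro: smult_dvd)
  moreover have "smult ?c d = smult ?c u * f + smult ?c v * g"
    by (subst d(1)) (simp add: smult_add_right)
  ultimately show ?thesis by blast
qed

lemma monic_gcd:
  fixes f g :: "'a::field poly"
  assumes "f \<noteq> 0"
  shows "lead_coeff (monic_gcd f g) = 1" "monic_gcd f g dvd f" "monic_gcd f g dvd g"
    and "e dvd f \<Longrightarrow> e dvd g \<Longrightarrow> e dvd monic_gcd f g"
proof -
  obtain d u v where d: "lead_coeff d = 1" "d dvd f" "d dvd g" "d = u * f + v * g"
    using bezout_field_poly[OF assms] by blast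
  have "e dvd d" if "e dvd f" "e dvd g" for e using that d(4) by auto
  with d have "monic_gcd f g = d" by (intro monic_gcd_eqI) auto
  with d show "lead_coeff (monic_gcd f g) = 1" "monic_gcd f g dvd f" "monic_gcd f g dvd g"
    and "e dvd f \<Longrightarrow> e dvd g \<Longrightarrow> e dvd monic_gcd f g" by auto
qed

lemma monic_irreducible_dvd_prod:
  fixes S :: "'a::field poly set"
  assumes "finite S" "\<forall>\<pi>\<in>S. irreducible \<pi> \<and> lead_coeff \<pi> = 1"
    and "irreducible p" "lead_coeff p = 1"
  shows "p dvd (\<Prod>\<pi>\<in>S. \<pi>) \<longleftrightarrow> p \<in> S"
proof
  assume "p dvd (\<Prod>\<pi>\<in>S. \<pi>)"
  then obtain q where q: "q \<in> S" "p dvd q"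
    using prime_elem_dvd_prod_msetE[OF field_poly_irreducible_imp_prime[OF assms(3)],
        of "image_mset (\<lambda>\<pi>. \<pi>) (mset_set S)"] assms(1)
    unfolding prod_unfold_prod_mset by auto
  have "q dvd p"
    using q assms(2,3) irreducible_not_unit by (metis irreducibleD' )
  with q assms(2,4) show "p \<in> S" using monic_dvd_antisym by blast
qed (use assms(1) in auto)

lemma distinct_irreducible_product_unique:
  assumes "distinct_irreducible_product h r"
  shows "r = card {p. irreducible p \<and> lead_coeff p = 1 \<and> p dvd h}"
proof -
  from assms obtain c S where S: "c \<noteq> 0" "finite S" "card S = r"
    "\<forall>\<pi>\<in>S. irreducible \<pi> \<and> lead_coeff \<pi> = 1" "h = smult c (\<Prod>\<pi>\<in>S. \<pi>)"
    unfolding distinct_irreducible_product_def by blast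
  have "p dvd h \<longleftrightarrow> p \<in> S" if "irreducible p" "lead_coeff p = 1" for p
    using monic_irreducible_dvd_prod[OF S(2,4) that] S(1,5) by (simp add: dvd_smult_iff)
  with S(4) have "S = {p. irreducible p \<and> lead_coeff p = 1 \<and> p dvd h}" by auto
  with S(3) show ?thesis by simp
qed

lemma monic_irreducible_factor_exists:
  fixes x :: "'a::field poly"
  assumes "x \<noteq> 0" "\<not> is_unit x"
  shows "\<exists>p. irreducible p \<and> lead_coeff p = 1 \<and> p dvd x"
proof -
  define P where "P = (\<lambda>p. p dvd x \<and> \<not> is_unit p)"
  have "P x" using assms by (simp add: P_def)
  then obtain p where "P p" and min: "\<And>e. P e \<Longrightarrow> degree p \<le> degree e"
    using ex_has_least_nat[of P x degree] by blast
  hence p: "p dvd x" "\<not> is_unit p" "p \<noteq> 0" using assms unfolding P_def by auto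
  define q where "q = smult (inverse (lead_coeff p)) p"
  have q: "q dvd x" "\<not> is_unit q" "q \<noteq> 0" "lead_coeff q = 1" "degree q = degree p"
    using p by (auto simp: q_def smult_dvd_iff)
  have "irreducible q"
  proof (rule irreducibleI)
    fix a b assume ab: "q = a * b"
    show "is_unit a \<or> is_unit b"
    proof (rule ccontr)
      assume *: "\<not> (is_unit a \<or> is_unit b)"
      have "a dvd x" "b dvd x"
        using ab q(1) by (auto dest: dvd_mult_left dvd_mult_right)
      hence "degree p \<le> degree a" "degree p \<le> degree b" using min * by (auto simp: P_def)
      moreover have "degree p = degree a + degree b"
        using ab q(3,5) by (metis degree_mult_eq mult_eq_0_iff)
      ultimately have "degree a = 0" by simp
      moreover have "a \<noteq> 0" using ab q(3) by auto
      ultimately have "is_unit a" by (simp add: is_unit_iff_degree)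
      with * show False by blast
    qed
  qed (use q in auto)
  with q show ?thesis by blast
qed

lemma distinct_irreducible_product_squarefree:
  assumes "distinct_irreducible_product h r"
  shows "squarefree h"
proof -
  from assms obtain c S where S: "c \<noteq> 0" "finite S"
    "\<forall>\<pi>\<in>S. irreducible \<pi> \<and> lead_coeff \<pi> = 1" "h = smult c (\<Prod>\<pi>\<in>S. \<pi>)"
    unfolding distinct_irreducible_product_def by blast
  have h0: "h \<noteq> 0" using S by auto
  show ?thesis
  proof (rule squarefreeI, rule ccontr)
    fix x assume x: "x ^ 2 dvd h" "\<not> is_unit x"
    have "x \<noteq> 0" using x(1) h0 by auto
    obtain p where p: "irreducible p" "lead_coeff p = 1" "p dvd x"
      using monic_irreducible_factor_exists[OF \<open>x \<noteq> 0\<close> x(2)] by blast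
    have "p ^ 2 dvd h" using p(3) x(1) by (meson dvd_power_same dvd_trans)
    hence *: "p * p dvd (\<Prod>\<pi>\<in>S. \<pi>)" using S by (simp add: dvd_smult_iff power2_eq_square)
    hence "p dvd (\<Prod>\<pi>\<in>S. \<pi>)" by (rule dvd_mult_left)
    hence "p \<in> S" using monic_irreducible_dvd_prod[OF S(2,3) p(1,2)] by blast
    hence "p * p dvd p * (\<Prod>\<pi>\<in>S-{p}. \<pi>)" using * S(2) by (simp add: prod.remove)
    hence "p dvd (\<Prod>\<pi>\<in>S-{p}. \<pi>)" using p(1) by auto
    thus False using monic_irreducible_dvd_prod[of "S - {p}" p] S p by auto
  qed
qed

lemma squarefree_distinct_irreducible_product:
  assumes "squarefree h"
  shows "\<exists>r. distinct_irreducible_product h r"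
  using assms
proof (induction "degree h" arbitrary: h rule: less_induct)
  case less
  have "h \<noteq> 0" using less.prems squarefreeD[of 0 "[:0, 1:]"] by (auto simp: is_unit_pCons_iff)
  show ?case
  proof (cases "is_unit h")
    case True
    then obtain c where "h = [:c:]" "c \<noteq> 0"
      by (metis \<open>h \<noteq> 0\<close> degree_eq_zeroE is_unit_iff_degree pCons_0_0)
    hence "h = smult c (\<Prod>\<pi>\<in>{}. \<pi>)" by (simp add: one_pCons)
    with \<open>c \<noteq> 0\<close> show ?thesis
      unfolding distinct_irreducible_product_def
      by (intro exI[of _ 0] exI[of _ c] exI[of _ "{}"]) auto
  next
    case False
    then obtain p where p: "irreducible p" "lead_coeff p = 1" "p dvd h"
      using monic_irreducible_factor_exists[OF \<open>h \<noteq> 0\<close>] by blast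
    then obtain k where k: "h = p * k" by blast
    have k0: "k \<noteq> 0" "p \<noteq> 0" using k \<open>h \<noteq> 0\<close> by auto
    have "degree p > 0" using p(1) k0(2) by (metis irreducible_not_unit is_unit_iff_degree not_gr0)
    hence "degree k < degree h" using k k0 by (simp add: degree_mult_eq)
    moreover have "squarefree k"
      using less.prems k by (meson dvd_triv_right squarefree_mono)
    ultimately obtain c S where S: "c \<noteq> 0" "finite S"
        "\<forall>\<pi>\<in>S. irreducible \<pi> \<and> lead_coeff \<pi> = 1" "k = smult c (\<Prod>\<pi>\<in>S. \<pi>)"
      using less.hyps unfolding distinct_irreducible_product_def by metis
    have "p \<notin> S"
    proof
      assume "p \<in> S"
      hence "p dvd k" using S by (auto simp: dvd_smult_iff)
      hence "p ^ 2 dvd h" using k by (simp add: power2_eq_square mult_dvd_mono)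
      thus False using less.prems p(1) irreducible_not_unit squarefreeD by blast
    qed
    hence "h = smult c (\<Prod>\<pi>\<in>insert p S. \<pi>)" using k S by simp
    with S p show ?thesis
      unfolding distinct_irreducible_product_def
      by (intro exI[of _ "card (insert p S)"] exI[of _ c] exI[of _ "insert p S"]) auto
  qed
qed

lemma poly_mobius_eq:
  assumes "distinct_irreducible_product h r"
  shows "poly_mobius h = (-1) ^ r"
proof -
  have "(THE r. distinct_irreducible_product h r) = r"
  proof (rule the_equality)
    fix r' assume "distinct_irreducible_product h r'"
    thus "r' = r" using assms by (auto dest!: distinct_irreducible_product_unique)
  qed (fact assms)
  with distinct_irreducible_product_squarefree[OF assms] show ?thesis by (simp add: poly_mobius_def)
qed

lemma card_eq_CHAR_power: "\<exists>n. CARD('a::finite_field) = CHAR('a) ^ n"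
proof -
  define G :: "'a monoid" where "G = \<lparr>carrier = UNIV, monoid.mult = (+), one = 0\<rparr>"
  have G: "Group.group G"
    by (rule groupI) (auto simp: G_def add.assoc intro: exI[of _ "- x" for x])
  have *: "r = CHAR('a)" if r: "prime r" "r dvd CARD('a)" for r
  proof -
    from r obtain m where "CARD('a) = r ^ 1 * m" by auto
    then obtain H where H: "subgroup H G" "card H = r ^ 1"
      using sylow_thm[OF r(1) G, of 1 m] by (auto simp: G_def Coset.order_def)
    have "card H > 1" using H(2) prime_gt_1_nat[OF r(1)] by simp
    then obtain x where x: "x \<in> H" "x \<noteq> 0"
      by (metis One_nat_def card.empty card_1_singleton_iff less_numeral_extra(4) not_one_less_zero
            singleton_iff subsetI subset_singletonD)
    have "x + y \<in> H" if "y \<in> H" for y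
      using subgroup.m_closed[OF H(1) x(1) that] by (simp add: G_def)
    hence "(\<lambda>y. x + y) ` H \<subseteq> H" by auto
    hence img: "(\<lambda>y. x + y) ` H = H" by (intro endo_inj_surj) auto
    have "\<Sum>H = (\<Sum>y\<in>H. x + y)"
      by (subst (1) img [symmetric]) (simp add: sum.reindex)
    also have "\<dots> = of_nat (card H) * x + \<Sum>H" by (simp add: sum.distrib)
    finally have "of_nat r * x = 0" using H(2) by simp
    hence "(of_nat r :: 'a) = 0" using x(2) by simp
    hence "CHAR('a) dvd r" by (simp add: of_nat_eq_0_iff_char_dvd)
    thus ?thesis using r(1) by (metis CHAR_prime primes_dvd_imp_eq)
  qed
  have "prime_factors CARD('a) \<subseteq> {CHAR('a)}" using * by (auto simp: in_prime_factors_iff)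
  hence "prime_factors CARD('a) = {} \<or> prime_factors CARD('a) = {CHAR('a)}" by blast
  moreover have "CARD('a) = (\<Prod>r\<in>prime_factors CARD('a). r ^ multiplicity r CARD('a))"
    by (rule prime_factorization_nat) simp
  ultimately have "CARD('a) = (\<Prod>r\<in>{}. r ^ multiplicity r CARD('a)) \<or>
      CARD('a) = (\<Prod>r\<in>{CHAR('a)}. r ^ multiplicity r CARD('a))"
    by (elim disjE) (simp only: simp_thms)+
  hence "CARD('a) = CHAR('a) ^ 0 \<or> CARD('a) = CHAR('a) ^ multiplicity CHAR('a) CARD('a)"
    by (auto simp del: One_nat_def)
  thus ?thesis by blast
qed

lemma card_eq_CHAR_power_degree:
  "CARD('a::finite_field) = CHAR('a) ^ prime_field_degree TYPE('a)"
proof -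
  have "CHAR('a) > 1" by (rule prime_gt_1_nat) simp
  thus ?thesis
    unfolding prime_field_degree_def using card_eq_CHAR_power[where ?'a = 'a]
    by (metis (mono_tags, lifting) power_inject_exp the_equality)
qed

lemma trace_rep:
  fixes x :: "'a::finite_field"
  shows "trace_rep x < CHAR('a)" "of_nat (trace_rep x) = field_trace x"
proof -
  let ?p = "CHAR('a)" and ?n = "prime_field_degree TYPE('a)"
  have p: "prime ?p" by simp
  then have "?p > 1" by (rule prime_gt_1_nat)
  note p = p this
  have "field_trace x ^ ?p = (\<Sum>i<?n. x ^ ?p ^ Suc i)"
    by (simp add: field_trace_def freshmans_dream_sum power_mult [symmetric] mult.commute)
  also have "\<dots> + x ^ ?p ^ 0 = (\<Sum>i<Suc ?n. x ^ ?p ^ i)"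
    by (subst sum.lessThan_Suc_shift) simp
  also have "\<dots> = field_trace x + x"
    using finite_field_power_card_eq_same[of x]
    by (simp add: field_trace_def card_eq_CHAR_power_degree)
  finally have root: "field_trace x ^ ?p = field_trace x" by simp
  have inj: "inj_on (of_nat :: nat \<Rightarrow> 'a) {..<?p}"
  proof (rule linorder_inj_onI)
    fix k l assume "k < l" "k \<in> {..<?p}" "l \<in> {..<?p}"
    then show "(of_nat k :: 'a) \<noteq> of_nat l"
      by (auto simp: of_nat_eq_iff_char_dvd dest!: dvd_imp_le)
  qed auto
  define q :: "'a poly" where "q = monom 1 ?p - monom 1 1"
  have q: "q \<noteq> 0" "degree q \<le> ?p"
  proof -
    have "coeff q ?p = 1" using p(2) by (simp add: q_def)
    then show "q \<noteq> 0" by auto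
    show "degree q \<le> ?p"
      unfolding q_def using p(2) by (intro degree_diff_le) (auto intro: order.trans[OF degree_monom_le])
  qed
  have roots: "{y. poly q y = 0} = {y. y ^ ?p = y}" by (auto simp: q_def poly_monom)
  have nat: "of_nat k ^ ?p = (of_nat k :: 'a)" for k
    using p(2) by (induction k) (auto simp: freshmans_dream)
  have "of_nat ` {..<?p} = {y::'a. y ^ ?p = y}"
  proof (rule card_seteq)
    have "card {y::'a. y ^ ?p = y} \<le> ?p"
      using card_poly_roots_bound[OF q(1)] q(2) roots by simp
    thus "card {y::'a. y ^ ?p = y} \<le> card (of_nat ` {..<?p} :: 'a set)"
      using inj by (simp add: card_image)
  qed (use nat in auto)
  with root have "field_trace x \<in> of_nat ` {..<?p}" by blast
  then obtain k where "k < ?p" "of_nat k = field_trace x" by auto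
  hence "\<exists>!k. k < ?p \<and> of_nat k = field_trace x"
    using inj by (metis inj_onD lessThan_iff)
  from theI'[OF this] show "trace_rep x < ?p" "of_nat (trace_rep x) = field_trace x"
    by (auto simp: trace_rep_def)
qed

end

theory Submission
  imports Defs "HOL-Number_Theory.Cong"
begin

text \<open>
  Put \<open>\<chi> h = \<zeta>\<^bsup>Tr (\<psi> h)\<^esup>\<close>, an additive character of \<open>F[x]\<close>. Since \<open>\<psi>\<close> is non-degenerate and the
  trace is not identically zero, \<open>\<chi>\<close> is trivial on the ideal \<open>(h)\<close> only if \<open>f | h\<close>; call such a
  character primitive modulo \<open>f\<close> (\<open>nondegenerate_imp_primitive_character\<close>).
  Let \<open>d = gcd(f, g)\<close>, \<open>f = d t\<close> and \<open>g = d u\<close>. As \<open>u\<close> is invertible modulo \<open>t\<close>, the character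
  \<open>a \<mapsto> \<chi> (g a)\<close> is primitive modulo \<open>t\<close> (\<open>primitive_character_scale\<close>). In particular its value
  depends on \<open>a\<close> modulo \<open>t\<close> only.

  The reduction \<open>(F[x]/f)\<^sup>\<times> \<rightarrow> (F[x]/t)\<^sup>\<times>\<close> is a surjective homomorphism, with a kernel of some order
  \<open>N\<close>. Hence \<open>\<phi>(f) = N \<phi>(t)\<close>, and the Ramanujan sum is \<open>N\<close> times the sum of a character that is
  primitive modulo \<open>t\<close> over the units modulo \<open>t\<close> (\<open>sum_unit_residues_periodic\<close>). Integrality
  comes for free, as \<open>\<phi>(f) / \<phi>(t)\<close> is the integer \<open>N\<close>.

  It remains to see that the sum of a primitive character over the units modulo \<open>m\<close> is \<open>\<mu>(m)\<close>
  (\<open>sum_primitive_character_eq_mobius\<close>). Write \<open>m = p k\<close> with \<open>p\<close> irreducible. Some translation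
  by a multiple of \<open>k\<close> multiplies the character by a constant other than \<open>1\<close>, so the sum over the
  residues modulo \<open>m\<close> that are units modulo \<open>k\<close> vanishes. If \<open>p | k\<close>, these residues are the units
  modulo \<open>m\<close>, and the sum is \<open>0\<close>. If not, they are the units modulo \<open>m\<close> together with the
  multiples \<open>p c\<close> with \<open>c\<close> a unit modulo \<open>k\<close>. The latter contribute the sum of a primitive
  character modulo \<open>k\<close>, so removing \<open>p\<close> from the modulus changes the sign.
\<close>

section \<open>Invertibility modulo a polynomial\<close>

text \<open>
  This is coprimality to \<open>m\<close>, expressed by an inverse: in this form it passes to products, both of
  moduli and of arguments, by multiplying the inverses.
\<close>

definition unit_mod :: "'a::field poly \<Rightarrow> 'a poly \<Rightarrow> bool" where
  "unit_mod m a \<longleftrightarrow> (\<exists>b. m dvd a * b - 1)"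

definition unit_residues :: "'a::field poly \<Rightarrow> 'a poly set" where
  "unit_residues m = {a. a mod m = a \<and> unit_mod m a}"

lemma unit_mod_cong:
  assumes "m dvd a - b"
  shows "unit_mod m a \<longleftrightarrow> unit_mod m b"
proof -
  have "m dvd a * c - 1 \<longleftrightarrow> m dvd b * c - 1" for c
  proof -
    have "a * c - 1 = (b * c - 1) + (a - b) * c" by (simp add: algebra_simps)
    then show ?thesis using assms by (metis dvd_add_left_iff dvd_mult2)
  qed
  then show ?thesis by (simp add: unit_mod_def)
qed

lemma unit_mod_mod [simp]: "unit_mod m (a mod m) \<longleftrightarrow> unit_mod m a"
  by (intro unit_mod_cong) (simp add: mod_eq_dvd_iff[symmetric])

lemma unit_mod_1 [simp]: "unit_mod m 1"
  unfolding unit_mod_def by (intro exI[of _ 1]) simp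

lemma unit_mod_mult [simp]: "unit_mod m (a * b) \<longleftrightarrow> unit_mod m a \<and> unit_mod m b"
proof
  assume "unit_mod m (a * b)"
  then obtain c where "m dvd a * b * c - 1" by (auto simp: unit_mod_def)
  then have "m dvd a * (b * c) - 1" "m dvd b * (a * c) - 1" by (simp_all add: ac_simps)
  then show "unit_mod m a \<and> unit_mod m b" unfolding unit_mod_def by blast
next
  assume "unit_mod m a \<and> unit_mod m b"
  then obtain c d where c: "m dvd a * c - 1" and d: "m dvd b * d - 1" by (auto simp: unit_mod_def)
  have "(a * b) * (c * d) - 1 = (a * c - 1) * (b * d) + (b * d - 1)"
    by (simp add: algebra_simps)
  then have "m dvd (a * b) * (c * d) - 1" using c d by (metis dvd_add dvd_mult2)
  then show "unit_mod m (a * b)" unfolding unit_mod_def by blast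
qed

text \<open>
  If \<open>a\<close> is inverted by \<open>c\<close> modulo \<open>m\<close> and by \<open>d\<close> modulo \<open>n\<close>, then
  \<open>(1 - a c) (1 - a d)\<close> is divisible by \<open>m n\<close>, and it is \<open>1\<close> minus a multiple of \<open>a\<close>.
\<close>

lemma unit_mod_mult_modulus: "unit_mod (m * n) a \<longleftrightarrow> unit_mod m a \<and> unit_mod n a"
proof
  assume "unit_mod (m * n) a"
  then show "unit_mod m a \<and> unit_mod n a"
    unfolding unit_mod_def by (meson dvd_mult_left dvd_mult_right)
next
  assume "unit_mod m a \<and> unit_mod n a"
  then obtain c d where "m dvd a * c - 1" "n dvd a * d - 1" by (auto simp: unit_mod_def)
  then have "m * n dvd (a * c - 1) * (a * d - 1)" by (rule mult_dvd_mono)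
  also have "(a * c - 1) * (a * d - 1) = - (a * (c + d - a * c * d) - 1)"
    by (simp add: algebra_simps)
  finally show "unit_mod (m * n) a" unfolding unit_mod_def dvd_minus_iff by blast
qed

lemma unit_mod_dvd: "m dvd n \<Longrightarrow> unit_mod n a \<Longrightarrow> unit_mod m a"
  by (auto simp: unit_mod_mult_modulus)

lemma unit_mod_unit: "is_unit m \<Longrightarrow> unit_mod m a"
  by (simp add: unit_mod_def unit_imp_dvd)

lemma unit_mod_irreducible:
  assumes "irreducible p"
  shows "unit_mod p a \<longleftrightarrow> \<not> p dvd a"
proof
  assume "unit_mod p a"
  then obtain b where b: "p dvd a * b - 1" by (auto simp: unit_mod_def)
  show "\<not> p dvd a"
  proof
    assume "p dvd a"
    then have "p dvd a * b - (a * b - 1)" by (intro dvd_diff b) simp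
    then show False using assms irreducible_not_unit by auto
  qed
next
  assume *: "\<not> p dvd a"
  have "p \<noteq> 0" using assms by auto
  then obtain d u v where d: "d dvd p" "d dvd a" "d = u * p + v * a"
    using bezout_field_poly by blast
  have "is_unit d"
    using irreducibleD'[OF assms d(1)] * d(2) by (metis dvd_trans)
  then obtain w where "1 = d * w" by blast
  then have "a * (v * w) - 1 = p * (- u * w)" using d(3) by (simp add: algebra_simps)
  then show "unit_mod p a" unfolding unit_mod_def by (metis dvd_triv_left)
qed

lemma unit_mod_cancel_dvd:
  assumes "unit_mod m a" and "m dvd a * b"
  shows "m dvd b"
proof -
  obtain c where "m dvd a * c - 1" using assms(1) by (auto simp: unit_mod_def)
  then have "m dvd (a * b) * c - (a * c - 1) * b" using assms(2) by (intro dvd_diff) auto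
  then show ?thesis by (simp add: algebra_simps)
qed

section \<open>Reduction of units to a divisor of the modulus\<close>

lemma irreducible_factor_split:
  fixes m :: "'a::field poly"
  assumes "m \<noteq> 0" and "\<not> is_unit m"
  obtains p k where "irreducible p" "lead_coeff p = 1" "m = p * k" "k \<noteq> 0" "degree k < degree m"
proof -
  obtain p k where p: "irreducible p" "lead_coeff p = 1" and m: "m = p * k"
    using monic_irreducible_factor_exists[OF assms] by blast
  have nz: "p \<noteq> 0" "k \<noteq> 0" using m assms(1) by auto
  have "degree p > 0" using p(1) nz(1) by (metis irreducible_not_unit is_unit_iff_degree not_gr0)
  then have "degree k < degree m" using m nz by (simp add: degree_mult_eq)
  with p m nz that show thesis by blast
qed

text \<open>
  Surjectivity of \<open>(F[x]/f)\<^sup>\<times> \<rightarrow> (F[x]/t)\<^sup>\<times>\<close>. The irreducible factors of \<open>f\<close> are treated one at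
  a time: if a new factor \<open>p\<close> of \<open>f = p f'\<close> divides the lift modulo \<open>f'\<close>, then \<open>p\<close> divides
  neither \<open>t\<close> nor \<open>f'\<close>, so adding \<open>t f'\<close> repairs the lift at \<open>p\<close> and changes nothing
  modulo \<open>f'\<close>.
\<close>

lemma unit_mod_lift:
  assumes "f \<noteq> 0" and "unit_mod t b"
  shows "\<exists>x. unit_mod f (b + t * x)"
  using assms(1)
proof (induction "degree f" arbitrary: f rule: less_induct)
  case less
  show ?case
  proof (cases "is_unit f")
    case True
    then show ?thesis by (auto intro: unit_mod_unit)
  next
    case False
    then obtain p f' where p: "irreducible p" and f: "f = p * f'"
        and f': "f' \<noteq> 0" "degree f' < degree f"
      using irreducible_factor_split[OF less.prems] by blast
    obtain x where x: "unit_mod f' (b + t * x)" using less.hyps[OF f'(2,1)] by blast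
    show ?thesis
    proof (cases "p dvd b + t * x")
      case False
      then show ?thesis using x unit_mod_irreducible[OF p] f unit_mod_mult_modulus by blast
    next
      case True
      have "\<not> p dvd f'" 
        using True x unit_mod_dvd unit_mod_irreducible[OF p] by blast
      moreover have "\<not> p dvd t"
      proof
        assume "p dvd t"
        then have "p dvd b" using True by (metis dvd_add_left_iff dvd_mult2)
        moreover have "unit_mod p b" using \<open>p dvd t\<close> assms(2) unit_mod_dvd by blast
        ultimately show False using unit_mod_irreducible[OF p] by blast
      qed
      ultimately have "\<not> p dvd t * f'"
        using field_poly_irreducible_imp_prime[OF p] prime_elem_dvd_mult_iff by blast
      moreover have eq: "b + t * (x + f') = (b + t * x) + t * f'" by (simp add: algebra_simps)
      ultimately have "unit_mod p (b + t * (x + f'))"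
        unfolding unit_mod_irreducible[OF p] eq using True dvd_add_right_iff by blast
      moreover have "unit_mod f' (b + t * (x + f'))"
        using x unit_mod_cong[of f' "b + t * (x + f')" "b + t * x"] by (simp add: eq)
      ultimately show ?thesis using f unit_mod_mult_modulus by blast
    qed
  qed
qed

lemma finite_residues:
  fixes m :: "'a::{field,finite} poly"
  assumes "m \<noteq> 0"
  shows "finite {a. a mod m = a \<and> P a}"
proof (rule finite_subset)
  show "{a. a mod m = a \<and> P a} \<subseteq> Poly ` {xs. set xs \<subseteq> UNIV \<and> length xs \<le> degree m + 1}"
  proof
    fix a assume "a \<in> {a. a mod m = a \<and> P a}"
    then have "degree a \<le> degree m" 
      using degree_mod_less'[OF assms] by (metis (mono_tags) degree_0 le0 mem_Collect_eq order_less_imp_le)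
    then have "length (coeffs a) \<le> degree m + 1" by (cases "a = 0") (auto simp: length_coeffs)
    then show "a \<in> Poly ` {xs. set xs \<subseteq> UNIV \<and> length xs \<le> degree m + 1}"
      by (intro image_eqI[of _ _ "coeffs a"]) auto
  qed
qed (simp only: finite_imageI finite_lists_length_le finite)

lemma finite_unit_residues: "m \<noteq> 0 \<Longrightarrow> finite (unit_residues (m :: 'a::{field,finite} poly))"
  unfolding unit_residues_def by (rule finite_residues)

lemma unit_residues_mod [simp]: "unit_mod m a \<Longrightarrow> a mod m \<in> unit_residues m"
  by (simp add: unit_residues_def)

text \<open>
  Every fibre of the reduction \<open>(F[x]/f)\<^sup>\<times> \<rightarrow> (F[x]/t)\<^sup>\<times>\<close> is a coset of its kernel, because the
  map is a surjective homomorphism.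
\<close>

lemma card_unit_reduction_fibre:
  fixes f t :: "'a::{field,finite} poly"
  assumes "f \<noteq> 0" and "t dvd f" and "b \<in> unit_residues t"
  shows "card {a \<in> unit_residues f. a mod t = b} = card {a \<in> unit_residues f. a mod t = 1 mod t}"
proof -
  have b: "b mod t = b" "unit_mod t b" using assms(3) by (auto simp: unit_residues_def)
  obtain x where x: "unit_mod f (b + t * x)" using unit_mod_lift[OF assms(1) b(2)] by blast
  define u where "u = b + t * x"
  obtain v where v: "f dvd u * v - 1" using x by (auto simp: u_def unit_mod_def)
  have u: "unit_mod f u" using x by (simp add: u_def)
  have vu: "unit_mod f v" using v unit_mod_def by (metis mult.commute)
  have uv: "(u * v) mod f = 1 mod f" using v by (simp add: mod_eq_dvd_iff)
  have uvt: "(u * v) mod t = 1 mod t" using dvd_trans[OF assms(2) v] by (simp add: mod_eq_dvd_iff)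
  have ut: "u mod t = b" using b by (simp add: u_def)
  have modmod: "(a mod f) mod t = a mod t" for a using assms(2) by (rule mod_mod_cancel)
  have inv: "(v * (u * a mod f)) mod f = a" "(u * (v * a mod f)) mod f = a" if "a mod f = a" for a
  proof -
    have "(v * (u * a mod f)) mod f = ((u * v) mod f * a) mod f"
      by (simp add: mod_mult_right_eq mod_mult_left_eq ac_simps)
    also have "\<dots> = a" unfolding uv using that by (simp add: mod_mult_left_eq)
    finally show "(v * (u * a mod f)) mod f = a" .
    have "(u * (v * a mod f)) mod f = ((u * v) mod f * a) mod f"
      by (simp add: mod_mult_right_eq mod_mult_left_eq ac_simps)
    also have "\<dots> = a" unfolding uv using that by (simp add: mod_mult_left_eq)
    finally show "(u * (v * a mod f)) mod f = a" .
  qed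
  \<comment> \<open>Multiplication by the lift \<open>u\<close> of \<open>b\<close> carries the fibre over \<open>1\<close> to the fibre over \<open>b\<close>.\<close>
  have "bij_betw (\<lambda>a. (u * a) mod f) {a \<in> unit_residues f. a mod t = 1 mod t}
          {a \<in> unit_residues f. a mod t = b}"
  proof (rule bij_betw_byWitness[where f' = "\<lambda>a. (v * a) mod f"])
    show "(\<lambda>a. u * a mod f) ` {a \<in> unit_residues f. a mod t = 1 mod t}
        \<subseteq> {a \<in> unit_residues f. a mod t = b}"
    proof safe
      fix a assume a: "a \<in> unit_residues f" "a mod t = 1 mod t"
      show "u * a mod f \<in> unit_residues f" using a u by (simp add: unit_residues_def)
      have "(u * a) mod t = (u * (a mod t)) mod t" by (simp add: mod_mult_right_eq)
      also have "\<dots> = b" unfolding a(2) by (simp add: mod_mult_right_eq ut)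
      finally show "u * a mod f mod t = b" by (simp add: modmod)
    qed
    show "(\<lambda>a. v * a mod f) ` {a \<in> unit_residues f. a mod t = b}
        \<subseteq> {a \<in> unit_residues f. a mod t = 1 mod t}"
    proof safe
      fix a assume a: "a \<in> unit_residues f" "b = a mod t"
      show "v * a mod f \<in> unit_residues f" using a vu by (simp add: unit_residues_def)
      have "(v * a) mod t = (v * (u mod t)) mod t" unfolding ut a(2) by (simp add: mod_mult_right_eq)
      also have "\<dots> = 1 mod t" using uvt by (simp add: mod_mult_right_eq mult.commute)
      finally show "v * a mod f mod t = 1 mod t" by (simp add: modmod)
    qed
  qed (auto simp: inv unit_residues_def)
  then show ?thesis by (simp add: bij_betw_same_card)
qed

lemma sum_unit_residues_periodic:
  fixes f t :: "'a::{field,finite} poly" and F :: "'a poly \<Rightarrow> complex"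
  assumes "f \<noteq> 0" and "t dvd f" and "\<And>a. F (a mod t) = F a"
  shows "(\<Sum>a\<in>unit_residues f. F a)
    = of_nat (card {a \<in> unit_residues f. a mod t = 1 mod t}) * (\<Sum>b\<in>unit_residues t. F b)"
proof -
  have t0: "t \<noteq> 0" using assms by auto
  have sub: "(\<lambda>a. a mod t) ` unit_residues f \<subseteq> unit_residues t"
    using unit_mod_dvd[OF assms(2)] by (auto simp: unit_residues_def)
  have "(\<Sum>a\<in>unit_residues f. F a)
      = (\<Sum>b\<in>unit_residues t. \<Sum>a\<in>{a \<in> unit_residues f. a mod t = b}. F a)"
    by (rule sum.group[symmetric])
       (use sub in \<open>simp_all add: finite_unit_residues[OF assms(1)] finite_unit_residues[OF t0]\<close>)
  also have "\<dots> = (\<Sum>b\<in>unit_residues t. 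
      of_nat (card {a \<in> unit_residues f. a mod t = 1 mod t}) * F b)"
  proof (rule sum.cong)
    fix b assume b: "b \<in> unit_residues t"
    have "(\<Sum>a\<in>{a \<in> unit_residues f. a mod t = b}. F a)
        = (\<Sum>a\<in>{a \<in> unit_residues f. a mod t = b}. F b)"
      by (rule sum.cong) (use assms(3) in auto)
    also have "\<dots> = of_nat (card {a \<in> unit_residues f. a mod t = b}) * F b" by simp
    also have "\<dots> = of_nat (card {a \<in> unit_residues f. a mod t = 1 mod t}) * F b"
      by (simp only: card_unit_reduction_fibre[OF assms(1,2) b])
    finally show "(\<Sum>a\<in>{a \<in> unit_residues f. a mod t = b}. F a)
      = of_nat (card {a \<in> unit_residues f. a mod t = 1 mod t}) * F b" .
  qed simp
  finally show ?thesis by (simp add: sum_distrib_left)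
qed

section \<open>Sums of primitive additive characters over units\<close>

text \<open>
  One direction of the equivalence is periodicity modulo \<open>m\<close>. The other is primitivity: no ideal
  outside \<open>(m)\<close> lies in the kernel.
\<close>

definition primitive_character :: "'a::field poly \<Rightarrow> ('a poly \<Rightarrow> complex) \<Rightarrow> bool" where
  "primitive_character m \<chi> \<longleftrightarrow> (\<forall>a b. \<chi> (a + b) = \<chi> a * \<chi> b) \<and>
     (\<forall>h. (\<forall>x. \<chi> (h * x) = 1) \<longleftrightarrow> m dvd h)"

lemma primitive_character_add: "primitive_character m \<chi> \<Longrightarrow> \<chi> (a + b) = \<chi> a * \<chi> b"
  by (simp add: primitive_character_def)

lemma primitive_character_0: "primitive_character m \<chi> \<Longrightarrow> \<chi> 0 = 1"
  unfolding primitive_character_def by (metis dvd_0_right mult_zero_left)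

lemma primitive_character_cong:
  assumes "primitive_character m \<chi>" and "m dvd a - b"
  shows "\<chi> a = \<chi> b"
proof -
  have "\<chi> ((a - b) * 1) = 1" using assms unfolding primitive_character_def by blast
  then show ?thesis using primitive_character_add[OF assms(1), of "a - b" b] by simp
qed

lemma primitive_character_mod: "primitive_character m \<chi> \<Longrightarrow> \<chi> (a mod m) = \<chi> a"
  using primitive_character_cong mod_eq_dvd_iff mod_mod_trivial by metis

lemma primitive_character_ex_neq_1:
  assumes "primitive_character m \<chi>" and "\<not> m dvd h"
  obtains x where "\<chi> (h * x) \<noteq> 1"
  using assms unfolding primitive_character_def by blast

text \<open>
  Freezing a factor of the argument lowers the modulus: \<open>m | g h\<close> means that \<open>t | h\<close> as soon as
  \<open>m = d t\<close> and \<open>g = d u\<close> with \<open>u\<close> invertible modulo \<open>t\<close>.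
\<close>

lemma primitive_character_scale:
  assumes "primitive_character (d * t) \<chi>" and "d \<noteq> 0" and "unit_mod t u"
  shows "primitive_character t (\<lambda>a. \<chi> (d * u * a))"
proof -
  have "d * t dvd d * u * h \<longleftrightarrow> t dvd h" for h
  proof -
    have "d * t dvd d * u * h \<longleftrightarrow> t dvd u * h" using assms(2) by (simp add: mult.assoc)
    also have "\<dots> \<longleftrightarrow> t dvd h" using unit_mod_cancel_dvd[OF assms(3)] dvd_mult by blast
    finally show ?thesis .
  qed
  moreover have "(\<forall>x. \<chi> (d * u * h * x) = 1) \<longleftrightarrow> d * t dvd d * u * h" for h
    using assms(1) unfolding primitive_character_def by blast
  moreover have "\<chi> (d * u * (a + b)) = \<chi> (d * u * a) * \<chi> (d * u * b)" for a b
    unfolding distrib_left by (rule primitive_character_add[OF assms(1)])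
  ultimately show ?thesis unfolding primitive_character_def by (simp add: mult.assoc)
qed

text \<open>
  Summing over a set of residues that is stable under translation by \<open>s\<close> multiplies the sum by
  \<open>\<chi> s\<close>, so the sum is zero unless \<open>\<chi> s = 1\<close>.
\<close>

lemma sum_translation_invariant_eq_0:
  fixes m :: "'a::{field,finite} poly"
  assumes \<chi>: "primitive_character m \<chi>"
    and P: "\<And>a b. m dvd a - b \<Longrightarrow> P a \<longleftrightarrow> P b" "\<And>a. P (a + s) \<longleftrightarrow> P a"
    and s: "\<chi> s \<noteq> 1"
  shows "(\<Sum>a | a mod m = a \<and> P a. \<chi> a) = 0"
proof -
  let ?S = "\<Sum>a | a mod m = a \<and> P a. \<chi> a"
  have Pm: "P (a mod m) \<longleftrightarrow> P a" for a by (rule P(1)) (simp add: mod_eq_dvd_iff[symmetric])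
  have Ps: "P (a - s) \<longleftrightarrow> P a" for a using P(2)[of "a - s"] by simp
  have shift: "\<chi> ((a - s) mod m + s) = \<chi> a" for a
    by (rule primitive_character_cong[OF \<chi>]) (simp add: mod_eq_dvd_iff[symmetric] mod_add_left_eq)
  have "?S = (\<Sum>a | a mod m = a \<and> P a. \<chi> (a + s))"
    by (rule sum.reindex_bij_witness[where i = "\<lambda>a. (a + s) mod m" and j = "\<lambda>a. (a - s) mod m"])
       (auto simp: Pm P(2) Ps mod_diff_left_eq mod_add_left_eq shift)
  also have "\<dots> = ?S * \<chi> s" by (simp add: primitive_character_add[OF \<chi>] sum_distrib_right)
  finally show ?thesis using s by simp
qed

lemma poly_mobius_unit:
  fixes m :: "'a::field poly"
  assumes "is_unit m"
  shows "poly_mobius m = 1"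
proof -
  obtain c where "m = [:c:]" "c \<noteq> 0"
    using assms by (metis is_unit_poly_iff not_is_unit_0 pCons_0_0)
  then have "distinct_irreducible_product m 0"
    unfolding distinct_irreducible_product_def
    by (intro exI[of _ c] exI[of _ "{}"]) (auto simp: one_pCons)
  then show ?thesis by (simp add: poly_mobius_eq)
qed

lemma poly_mobius_mult_irreducible:
  fixes k :: "'a::field poly"
  assumes p: "irreducible p" "lead_coeff p = 1" and "\<not> p dvd k"
  shows "poly_mobius (p * k) = - poly_mobius k"
proof (cases "squarefree k")
  case True
  then obtain r where "distinct_irreducible_product k r"
    using squarefree_distinct_irreducible_product by blast
  then obtain c S where S: "c \<noteq> 0" "finite S" "card S = r"
      "\<forall>\<pi>\<in>S. irreducible \<pi> \<and> lead_coeff \<pi> = 1" "k = smult c (\<Prod>\<pi>\<in>S. \<pi>)"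
    and r: "distinct_irreducible_product k r"
    unfolding distinct_irreducible_product_def by blast
  have "p \<notin> S" using assms(3) S by (auto simp: dvd_smult_iff)
  then have "distinct_irreducible_product (p * k) (Suc r)"
    unfolding distinct_irreducible_product_def
    by (intro exI[of _ c] exI[of _ "insert p S"]) (use S p in auto)
  with r show ?thesis by (simp add: poly_mobius_eq)
next
  case False
  then have "\<not> squarefree (p * k)" by (meson dvd_triv_right squarefree_mono)
  with False show ?thesis by (simp add: poly_mobius_def)
qed

text \<open>
  The inductive step behind the sum of a primitive character: translations by multiples of \<open>k\<close>
  kill the sum over the residues that are units modulo \<open>k\<close>, and these are the units modulo
  \<open>p k\<close> together with the multiples \<open>p c\<close> of \<open>p\<close>, where \<open>c\<close> runs through the units modulo \<open>k\<close>.
\<close>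

lemma sum_primitive_character_mult_irreducible:
  fixes k :: "'a::{field,finite} poly"
  assumes \<chi>: "primitive_character (p * k) \<chi>"
    and p: "irreducible p" and k: "k \<noteq> 0" and ndvd: "\<not> p dvd k"
  shows "(\<Sum>a\<in>unit_residues (p * k). \<chi> a) = - (\<Sum>c\<in>unit_residues k. \<chi> (p * c))"
proof -
  let ?m = "p * k"
  have p0: "p \<noteq> 0" and m0: "?m \<noteq> 0" using p k by auto
  have "\<not> is_unit p" using p irreducible_not_unit by blast
  then have "\<not> ?m dvd k" using k by (metis dvd_times_right_cancel_iff mult_1)
  then obtain x where x: "\<chi> (k * x) \<noteq> 1" using \<chi> primitive_character_ex_neq_1 by blast
  have "p dvd a \<or> unit_mod p a" for a using unit_mod_irreducible[OF p] by blast
  then have split: "{a. a mod ?m = a \<and> unit_mod k a}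
      = unit_residues ?m \<union> {a. a mod ?m = a \<and> (unit_mod k a \<and> p dvd a)}"
    using unit_mod_mult_modulus by (auto simp: unit_residues_def)
  have disj: "unit_residues ?m \<inter> {a. a mod ?m = a \<and> (unit_mod k a \<and> p dvd a)} = {}"
    using unit_mod_irreducible[OF p] by (auto simp: unit_residues_def unit_mod_mult_modulus)
  have "0 = (\<Sum>a | a mod ?m = a \<and> unit_mod k a. \<chi> a)"
  proof (rule sum_translation_invariant_eq_0[OF \<chi> _ _ x, symmetric])
    show "unit_mod k a \<longleftrightarrow> unit_mod k b" if "?m dvd a - b" for a b
      using that by (intro unit_mod_cong) (rule dvd_mult_right)
    show "unit_mod k (a + k * x) \<longleftrightarrow> unit_mod k a" for a by (intro unit_mod_cong) simp
  qed
  also have "\<dots> = (\<Sum>a\<in>unit_residues ?m. \<chi> a)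
      + (\<Sum>a | a mod ?m = a \<and> (unit_mod k a \<and> p dvd a). \<chi> a)"
    unfolding split
    by (rule sum.union_disjoint[OF finite_unit_residues[OF m0] finite_residues[OF m0] disj])
  also have "(\<Sum>a | a mod ?m = a \<and> (unit_mod k a \<and> p dvd a). \<chi> a)
      = (\<Sum>c\<in>unit_residues k. \<chi> (p * c))"
  proof (rule sum.reindex_bij_witness[where i = "\<lambda>c. p * c" and j = "\<lambda>a. a div p"])
    fix a assume a: "a \<in> {a. a mod ?m = a \<and> (unit_mod k a \<and> p dvd a)}"
    then obtain c where c: "a = p * c" by auto
    show "p * (a div p) = a" using c p0 by simp
    have "(p * c) mod (p * k) = p * (c mod k)" by (rule mult_mod_right[symmetric])
    then have "c mod k = c" using a c p0 by simp
    then show "a div p \<in> unit_residues k" using a c p0 by (simp add: unit_residues_def)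
    show "\<chi> (p * (a div p)) = \<chi> a" using c p0 by simp
  next
    have "unit_mod k p"
    proof -
      obtain b where "p dvd k * b - 1"
        using ndvd unit_mod_irreducible[OF p] by (auto simp: unit_mod_def)
      then obtain w where "k * b - 1 = p * w" by blast
      then have "p * (- w) - 1 = k * (- b)" by (simp add: algebra_simps)
      then show ?thesis unfolding unit_mod_def by (metis dvd_triv_left)
    qed
    moreover fix c assume "c \<in> unit_residues k"
    ultimately show "p * c \<in> {a. a mod ?m = a \<and> (unit_mod k a \<and> p dvd a)}"
      by (simp add: unit_residues_def mult_mod_right[symmetric])
    show "p * c div p = c" using p0 by simp
  qed
  finally show ?thesis by (simp add: eq_neg_iff_add_eq_0)
qed

theorem sum_primitive_character_eq_mobius:
  fixes m :: "'a::{field,finite} poly"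
  assumes "m \<noteq> 0" and "primitive_character m \<chi>"
  shows "(\<Sum>a\<in>unit_residues m. \<chi> a) = of_int (poly_mobius m)"
  using assms
proof (induction "degree m" arbitrary: m \<chi> rule: less_induct)
  case less
  note \<chi> = less.prems(2)
  show ?case
  proof (cases "is_unit m")
    case True
    then have "a mod m = 0" for a by (simp add: unit_imp_dvd)
    then have "unit_residues m = {0}"
      by (auto simp: unit_residues_def unit_mod_unit[OF True])
    then show ?thesis using primitive_character_0[OF \<chi>] by (simp add: poly_mobius_unit[OF True])
  next
    case False
    then obtain p k where p: "irreducible p" "lead_coeff p = 1" and m: "m = p * k"
        and k: "k \<noteq> 0" "degree k < degree m"
      using irreducible_factor_split[OF less.prems(1)] by blast
    have p0: "p \<noteq> 0" and nu: "\<not> is_unit p" using p(1) irreducible_not_unit by auto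
    show ?thesis
    proof (cases "p dvd k")
      case True
      \<comment> \<open>Every prime factor of \<open>m\<close> divides \<open>k\<close>, so translation by \<open>k x\<close> preserves units.\<close>
      have units: "unit_mod m a \<longleftrightarrow> unit_mod k a" for a
        unfolding m unit_mod_mult_modulus using unit_mod_dvd[OF True] by blast
      have "\<not> m dvd k" using k(1) nu unfolding m by (metis dvd_times_right_cancel_iff mult_1)
      then obtain x where x: "\<chi> (k * x) \<noteq> 1" using \<chi> primitive_character_ex_neq_1 by blast
      have "(\<Sum>a | a mod m = a \<and> unit_mod m a. \<chi> a) = 0"
      proof (rule sum_translation_invariant_eq_0[OF \<chi> unit_mod_cong _ x])
        show "unit_mod m (a + k * x) \<longleftrightarrow> unit_mod m a" for a
          unfolding units by (intro unit_mod_cong) simp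
      qed
      moreover have "p ^ 2 dvd m" using True m by (simp add: power2_eq_square)
      then have "\<not> squarefree m" using nu squarefreeD by blast
      ultimately show ?thesis by (simp add: unit_residues_def poly_mobius_def)
    next
      case False
      have "primitive_character k (\<lambda>c. \<chi> (p * c))"
        using primitive_character_scale[of p k \<chi> 1] \<chi> p0 m by simp
      then have "(\<Sum>c\<in>unit_residues k. \<chi> (p * c)) = of_int (poly_mobius k)"
        by (rule less.hyps[OF k(2,1)])
      then show ?thesis
        using sum_primitive_character_mult_irreducible[OF _ p(1) k(1) False] \<chi>
          poly_mobius_mult_irreducible[OF p False] m by simp
    qed
  qed
qed

section \<open>Residues and the quotient ring\<close>

lemma cring_poly_ring: "cring poly_ring"
  by (intro cringI abelian_groupI comm_monoidI)
     (auto simp: algebra_simps intro: exI[of _ "- x" for x])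

lemma ideal_PIdl_poly: "ideal (PIdl\<^bsub>poly_ring\<^esub> f) poly_ring"
  by (rule cring.cgenideal_ideal[OF cring_poly_ring]) simp

lemma cring_poly_quot: "cring (poly_quot f)"
  unfolding poly_quot_def by (rule ideal.quotient_is_cring[OF ideal_PIdl_poly cring_poly_ring])

lemma poly_class_hom: "poly_class f \<in> ring_hom poly_ring (poly_quot f)"
  using ideal.rcos_ring_hom[OF ideal_PIdl_poly, of f]
  by (simp add: poly_quot_def poly_class_def[abs_def])

lemma poly_class_mult: "poly_class f a \<otimes>\<^bsub>poly_quot f\<^esub> poly_class f b = poly_class f (a * b)"
  using ring_hom_mult[OF poly_class_hom[of f], of a b] by simp

lemma poly_class_add: "poly_class f a \<oplus>\<^bsub>poly_quot f\<^esub> poly_class f b = poly_class f (a + b)"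
  using ring_hom_add[OF poly_class_hom[of f], of a b] by simp

lemma poly_class_1: "poly_class f 1 = \<one>\<^bsub>poly_quot f\<^esub>"
  using ring_hom_one[OF poly_class_hom] by simp

lemma poly_class_0: "poly_class f 0 = \<zero>\<^bsub>poly_quot f\<^esub>"
  using ring_hom_zero[OF poly_class_hom cring.axioms(1)[OF cring_poly_ring]
      cring.axioms(1)[OF cring_poly_quot]] by simp

lemma carrier_poly_quot: "carrier (poly_quot f) = range (poly_class f)"
  by (auto simp: poly_quot_def FactRing_def A_RCOSETS_def' poly_class_def)

lemma poly_class_eq_iff: "poly_class f a = poly_class f b \<longleftrightarrow> f dvd a - b"
proof -
  have coset: "poly_class f h = {x * f + h | x. True}" for h
    by (auto simp: poly_class_def a_r_coset_def' cgenideal_def)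
  show ?thesis
  proof
    assume "poly_class f a = poly_class f b"
    moreover have "0 * f + a \<in> poly_class f a" unfolding coset by blast
    ultimately obtain x where "a = x * f + b" unfolding coset by auto
    then show "f dvd a - b" by simp
  next
    assume "f dvd a - b"
    then obtain k where "a - b = f * k" by blast
    then have a: "a = k * f + b" by (simp add: algebra_simps)
    have "x * f + a = (x + k) * f + b" "x * f + b = (x - k) * f + a" for x
      by (simp_all add: a algebra_simps)
    then show "poly_class f a = poly_class f b" unfolding coset by blast
  qed
qed

lemma poly_class_mod [simp]: "poly_class f (a mod f) = poly_class f a"
  by (simp add: poly_class_eq_iff mod_eq_dvd_iff[symmetric])

lemma poly_class_in_Units_iff: "poly_class f a \<in> Units (poly_quot f) \<longleftrightarrow> unit_mod f a"
proof -
  have "poly_class f a \<in> Units (poly_quot f)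
      \<longleftrightarrow> (\<exists>b. poly_class f (b * a) = poly_class f 1 \<and> poly_class f (a * b) = poly_class f 1)"
    by (simp add: Units_def carrier_poly_quot poly_class_mult poly_class_1)
  also have "\<dots> \<longleftrightarrow> unit_mod f a" by (simp add: unit_mod_def poly_class_eq_iff mult.commute)
  finally show ?thesis .
qed

lemma bij_betw_unit_residues_Units:
  "bij_betw (poly_class f) (unit_residues f) (Units (poly_quot f))"
proof (rule bij_betw_imageI)
  show "inj_on (poly_class f) (unit_residues f)"
  proof (rule inj_onI)
    fix a b assume "a \<in> unit_residues f" "b \<in> unit_residues f" "poly_class f a = poly_class f b"
    then show "a = b"
      unfolding poly_class_eq_iff mod_eq_dvd_iff[symmetric] by (simp add: unit_residues_def)
  qed
  show "poly_class f ` unit_residues f = Units (poly_quot f)"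
  proof
    show "poly_class f ` unit_residues f \<subseteq> Units (poly_quot f)"
      by (auto simp: poly_class_in_Units_iff unit_residues_def)
    show "Units (poly_quot f) \<subseteq> poly_class f ` unit_residues f"
    proof
      fix x assume x: "x \<in> Units (poly_quot f)"
      then obtain a where a: "x = poly_class f a" by (auto simp: Units_def carrier_poly_quot)
      then have "a mod f \<in> unit_residues f" using x by (simp add: poly_class_in_Units_iff)
      then show "x \<in> poly_class f ` unit_residues f" using a by (metis imageI poly_class_mod)
    qed
  qed
qed

lemma poly_phi_eq: "poly_phi f = card (unit_residues f)"
  unfolding poly_phi_def using bij_betw_same_card[OF bij_betw_unit_residues_Units] by metis

lemma ramanujan_sum_eq:
  "ramanujan_sum \<zeta> \<psi> g f = (\<Sum>a\<in>unit_residues f. \<zeta> ^ trace_rep (\<psi> (poly_class f (g * a))))"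
  unfolding ramanujan_sum_def sum.reindex_bij_betw[OF bij_betw_unit_residues_Units, symmetric]
  by (simp add: poly_class_mult)

section \<open>The character of a non-degenerate functional\<close>

lemma field_trace_add: "field_trace (x + y) = field_trace x + field_trace (y :: 'a::finite_field)"
proof -
  have p: "prime CHAR('a)" by simp
  have "(x + y) ^ (CHAR('a) ^ i) = x ^ (CHAR('a) ^ i) + y ^ (CHAR('a) ^ i)" for i
    by (rule freshmans_dream') (simp_all add: p)
  then show ?thesis by (simp add: field_trace_def sum.distrib)
qed

text \<open>
  The trace is a polynomial of degree \<open>q / p < q\<close> in its argument, so it cannot vanish at all
  \<open>q\<close> elements of the field.
\<close>

lemma field_trace_nonzero: "\<exists>x :: 'a::finite_field. field_trace x \<noteq> 0"
proof (rule ccontr)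
  let ?p = "CHAR('a)" and ?n = "prime_field_degree TYPE('a)"
  assume "\<not> ?thesis"
  then have zero: "field_trace x = 0" for x :: 'a by blast
  have p: "?p > 1" by (rule prime_gt_1_nat) simp
  have "CARD('a) \<noteq> 1" by (metis card_1_singletonE UNIV_I singletonD zero_neq_one)
  then have "?n \<noteq> 0" using card_eq_CHAR_power_degree[where ?'a = 'a] by (metis power_0)
  then obtain n where n: "?n = Suc n" by (metis not0_implies_Suc)
  define Q :: "'a poly" where "Q = (\<Sum>i<?n. monom 1 (?p ^ i))"
  have "coeff Q (?p ^ n) = (\<Sum>i<?n. if i = n then 1 else 0)"
    unfolding Q_def coeff_sum using p by (intro sum.cong) auto
  then have "Q \<noteq> 0" using n by auto
  have "degree Q \<le> ?p ^ n"
    unfolding Q_def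
  proof (rule degree_sum_le)
    fix i assume "i \<in> {..<?n}"
    then have "?p ^ i \<le> ?p ^ n" using n p by (intro power_increasing) auto
    then show "degree (monom (1::'a) (?p ^ i)) \<le> ?p ^ n" using degree_monom_le le_trans by blast
  qed simp
  moreover have "poly Q x = field_trace x" for x
    by (simp add: Q_def field_trace_def poly_sum poly_monom)
  then have "card {x. poly Q x = 0} = CARD('a)" by (simp add: zero)
  then have "CARD('a) \<le> degree Q" using card_poly_roots_bound[OF \<open>Q \<noteq> 0\<close>] by simp
  moreover have "?p ^ n < CARD('a)"
    using p n by (simp add: card_eq_CHAR_power_degree)
  ultimately show False by simp
qed

lemma power_trace_rep_add:
  fixes x y :: "'a::finite_field"
  assumes "\<zeta> ^ CHAR('a) = (1 :: complex)"
  shows "\<zeta> ^ trace_rep (x + y) = \<zeta> ^ trace_rep x * \<zeta> ^ trace_rep y"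
proof -
  let ?s = "trace_rep x + trace_rep y"
  have "(of_nat (trace_rep (x + y)) :: 'a) = of_nat ?s"
    by (simp add: trace_rep(2) field_trace_add)
  then have "trace_rep (x + y) mod CHAR('a) = ?s mod CHAR('a)"
    unfolding of_nat_eq_iff_cong_CHAR by (simp add: cong_def)
  moreover have "\<zeta> ^ k = \<zeta> ^ (k mod CHAR('a))" for k
  proof -
    have "\<zeta> ^ k = \<zeta> ^ (CHAR('a) * (k div CHAR('a)) + k mod CHAR('a))" by simp
    also have "\<dots> = \<zeta> ^ (k mod CHAR('a))" unfolding power_add power_mult assms by simp
    finally show ?thesis .
  qed
  ultimately have "\<zeta> ^ trace_rep (x + y) = \<zeta> ^ ?s" by metis
  then show ?thesis by (simp add: power_add)
qed

lemma power_trace_rep_eq_1_imp: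
  fixes x :: "'a::finite_field"
  assumes "primitive_root_of_unity CHAR('a) \<zeta>" and "\<zeta> ^ trace_rep x = 1"
  shows "field_trace x = 0"
proof -
  have "trace_rep x = 0"
    using assms trace_rep(1)[of x] unfolding primitive_root_of_unity_def by (meson gr0I)
  then show ?thesis using trace_rep(2)[of x] by simp
qed

text \<open>
  If the character is trivial on the ideal generated by \<open>h\<close>, then \<open>Tr (c \<psi>(h x)) = 0\<close> for all
  scalars \<open>c\<close>, as \<open>c\<close> can be absorbed into \<open>x\<close>. The trace is not identically zero, so \<open>\<psi>\<close>
  vanishes on this ideal and non-degeneracy makes \<open>h\<close> zero in the quotient.
\<close>

lemma nondegenerate_imp_primitive_character:
  fixes f :: "'a::finite_field poly"
  assumes "primitive_root_of_unity CHAR('a) \<zeta>" and \<psi>: "nondegenerate_functional f \<psi>"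
  shows "primitive_character f (\<lambda>a. \<zeta> ^ trace_rep (\<psi> (poly_class f a)))"
proof -
  have add: "\<psi> (poly_class f (a + b)) = \<psi> (poly_class f a) + \<psi> (poly_class f b)" for a b
    using \<psi> unfolding nondegenerate_functional_def quot_functional_def
    by (metis carrier_poly_quot poly_class_add rangeI)
  have scale: "\<psi> (poly_class f ([:c:] * a)) = c * \<psi> (poly_class f a)" for c a
    using \<psi> unfolding nondegenerate_functional_def quot_functional_def
    by (metis carrier_poly_quot poly_class_mult rangeI)
  have \<zeta>: "\<zeta> ^ CHAR('a) = 1" using assms(1) by (simp add: primitive_root_of_unity_def)
  have one: "f dvd a \<Longrightarrow> \<zeta> ^ trace_rep (\<psi> (poly_class f a)) = 1" for a
  proof -
    assume "f dvd a"
    then have "poly_class f a = poly_class f 0" by (simp add: poly_class_eq_iff)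
    moreover have "\<psi> (poly_class f 0) = 0" using add[of 0 0] by (metis add_0 add_cancel_right_right)
    moreover have "field_trace (0 :: 'a) = 0" 
      using field_trace_add[of 0 "0 :: 'a"] by (metis add_0 add_cancel_right_right)
    then have "CHAR('a) dvd trace_rep (0 :: 'a)"
      using trace_rep(2)[of "0 :: 'a"] of_nat_eq_0_iff_char_dvd by metis
    then have "\<zeta> ^ trace_rep (0 :: 'a) = 1" using \<zeta> by (auto simp: power_mult)
    ultimately show ?thesis by simp
  qed
  have "f dvd h" if h: "\<forall>x. \<zeta> ^ trace_rep (\<psi> (poly_class f (h * x))) = 1" for h
  proof -
    obtain y :: 'a where y: "field_trace y \<noteq> 0" using field_trace_nonzero by blast
    let ?I = "PIdl\<^bsub>poly_quot f\<^esub> (poly_class f h)"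
    have zero: "\<psi> (poly_class f (h * x)) = 0" for x
    proof (rule ccontr)
      let ?v = "\<psi> (poly_class f (h * x))"
      assume v: "?v \<noteq> 0"
      have "h * ([:y / ?v:] * x) = [:y / ?v:] * (h * x)" by (simp only: mult.left_commute)
      then have "\<psi> (poly_class f (h * ([:y / ?v:] * x))) = y / ?v * ?v" by (simp only: scale)
      also have "\<dots> = y" using v by simp
      finally have "\<psi> (poly_class f (h * ([:y / ?v:] * x))) = y" .
      with h have "\<zeta> ^ trace_rep y = 1" by metis
      then show False using y power_trace_rep_eq_1_imp[OF assms(1)] by blast
    qed
    have "ideal ?I (poly_quot f)"
      by (rule cring.cgenideal_ideal[OF cring_poly_quot]) (simp add: carrier_poly_quot)
    moreover have "\<psi> (poly_class f (x * h)) = 0" for x using zero[of x] by (simp only: mult.commute)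
    then have "\<forall>x\<in>?I. \<psi> x = 0" by (auto simp: cgenideal_def carrier_poly_quot poly_class_mult)
    ultimately have "?I = {\<zero>\<^bsub>poly_quot f\<^esub>}"
      using \<psi> unfolding nondegenerate_functional_def by blast
    moreover have "poly_class f h \<in> ?I"
      by (rule ring.cgenideal_self[OF cring.axioms(1)[OF cring_poly_quot]])
         (simp add: carrier_poly_quot)
    ultimately have "poly_class f h = poly_class f 0" by (simp add: poly_class_0)
    then show "f dvd h" by (simp add: poly_class_eq_iff)
  qed
  moreover have "\<zeta> ^ trace_rep (\<psi> (poly_class f (h * x))) = 1" if "f dvd h" for h x
    using that by (intro one) simp
  moreover have "\<zeta> ^ trace_rep (\<psi> (poly_class f (a + b)))
      = \<zeta> ^ trace_rep (\<psi> (poly_class f a)) * \<zeta> ^ trace_rep (\<psi> (poly_class f b))" for a b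
    unfolding add by (rule power_trace_rep_add[OF \<zeta>])
  ultimately show ?thesis unfolding primitive_character_def by blast
qed

text \<open>
  Dividing Bezout's identity \<open>d = a f + b g\<close> by \<open>d\<close> exhibits an inverse of \<open>g / d\<close> modulo
  \<open>f / d\<close>.
\<close>

section \<open>Evaluation of the Ramanujan sum\<close>

lemma monic_gcd_cofactors:
  fixes f g :: "'a::field poly"
  assumes "f \<noteq> 0"
  obtains u where "f = monic_gcd f g * (f div monic_gcd f g)" "g = monic_gcd f g * u"
    "unit_mod (f div monic_gcd f g) u"
proof -
  obtain d a b where d: "lead_coeff d = 1" "d dvd f" "d dvd g" "d = a * f + b * g"
    using bezout_field_poly[OF assms] by blast
  have gcd: "monic_gcd f g = d"
    using d by (intro monic_gcd_eqI) auto
  have d0: "d \<noteq> 0" using d(1) by auto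
  obtain t u where t: "f = d * t" and u: "g = d * u" using d(2,3) by blast
  have "d * (a * t + b * u) = d * 1" using d(4) by (simp add: t u algebra_simps)
  then have "a * t + b * u = 1" using d0 mult_left_cancel by blast
  then have "u * b - 1 = t * (- a)" by (simp add: algebra_simps)
  then have "unit_mod t u" unfolding unit_mod_def by (metis dvd_triv_left)
  moreover have "f div d = t" using t d0 by simp
  ultimately show thesis using that[of u] t u unfolding gcd by simp
qed

theorem theorem6p16:
  fixes f g t :: "'a::finite_field poly"
    and \<psi> :: "'a poly set \<Rightarrow> 'a"
    and p :: nat
    and \<zeta> :: complex
  assumes "CHAR('a) = p"
    and "lead_coeff f = 1"
    and "primitive_root_of_unity p \<zeta>"
    and "nondegenerate_functional f \<psi>"
    and "t = f div monic_gcd f g"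
  shows "ramanujan_sum \<zeta> \<psi> g f
           = of_int (poly_mobius t) * (of_nat (poly_phi f) / of_nat (poly_phi t))
         \<and> ramanujan_sum \<zeta> \<psi> g f \<in> \<int>"
proof -
  define \<chi> where "\<chi> = (\<lambda>a. \<zeta> ^ trace_rep (\<psi> (poly_class f a)))"
  define N where "N = card {a \<in> unit_residues f. a mod t = 1 mod t}"
  have f0: "f \<noteq> 0" using assms(2) by auto
  define d where "d = monic_gcd f g"
  obtain u where f: "f = d * t" and g: "g = d * u" and u: "unit_mod t u"
    using monic_gcd_cofactors[OF f0, of g] unfolding d_def assms(5) by blast
  have t: "t \<noteq> 0" "d \<noteq> 0" using f f0 by auto
  have dvd: "t dvd f" using f by (rule dvdI[OF trans[OF _ mult.commute]])
  have \<chi>: "primitive_character f \<chi>"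
    unfolding \<chi>_def using assms(1,3,4) by (intro nondegenerate_imp_primitive_character) auto
  then have "primitive_character (d * t) \<chi>" by (simp only: f)
  then have \<chi>t: "primitive_character t (\<lambda>a. \<chi> (g * a))"
    unfolding g by (rule primitive_character_scale[OF _ t(2) u])
  have "ramanujan_sum \<zeta> \<psi> g f = (\<Sum>a\<in>unit_residues f. \<chi> (g * a))"
    by (simp add: ramanujan_sum_eq \<chi>_def)
  also have "\<dots> = of_nat N * (\<Sum>b\<in>unit_residues t. \<chi> (g * b))"
    unfolding N_def using primitive_character_mod[OF \<chi>t]
    by (intro sum_unit_residues_periodic[OF f0 dvd]) simp
  also have "(\<Sum>b\<in>unit_residues t. \<chi> (g * b)) = of_int (poly_mobius t)"
    by (rule sum_primitive_character_eq_mobius[OF t(1) \<chi>t])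
  finally have sum: "ramanujan_sum \<zeta> \<psi> g f = of_nat N * of_int (poly_mobius t)" .
  have "of_nat (poly_phi f) = (of_nat (N * poly_phi t) :: complex)"
    using sum_unit_residues_periodic[OF f0 dvd, of "\<lambda>_. 1"] by (simp add: poly_phi_eq N_def)
  moreover have "1 mod t \<in> unit_residues t" by simp
  then have "poly_phi t \<noteq> 0"
    unfolding poly_phi_eq using finite_unit_residues[OF t(1)] by (metis card_0_eq empty_iff)
  ultimately have "of_nat (poly_phi f) / of_nat (poly_phi t) = (of_nat N :: complex)" by simp
  with sum show ?thesis by (simp add: mult.commute)
qed

end
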